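(* Let $PW=\{F\in L^2(\mathbb R):\operatorname{supp}\widehat F\subset[-1/2,1/2]\}$. The map $F\mapsto\big(\{F(n)\}_{n\ge0},\{-\tfrac{1}{2\pi i}F'(n)\}_{n<0}\big)$ on $PW$ is injective, but it is not stable: there is no $c>0$ such that $\sum_{n\ge0}|F(n)|^2+\sum_{n<0}\big|\tfrac{-1}{2\pi i}F'(n)\big|^2\ge c\|F\|_{L^2(\mathbb R)}^2$ for all $F\in PW$.
   Context: Functions in $PW$ are entire (continuous, differentiable) and are of the form $F(\xi)=\int_{-1/2}^{1/2}f(x)e^{-2\pi i\xi x}dx$ with $f\in L^2[-1/2,1/2]$; $n$ ranges over the integers. *)

theory Defs
  imports "HOL-Analysis.Analysis"
begin

definition L2_half :: "(real \<Rightarrow> complex) \<Rightarrow> bool" where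
  "L2_half f \<longleftrightarrow> f \<in> borel_measurable lborel \<and>
     set_integrable lborel {-1/2..1/2::real} (\<lambda>x. (norm (f x))\<^sup>2)"

definition PW :: "(complex \<Rightarrow> complex) set" where
  "PW = {F. \<exists>f. L2_half f \<and>
          (\<forall>z. F z = (LINT x:{-1/2..1/2::real}|lborel.
                          f x * exp (- 2 * complex_of_real pi * \<i> * z * complex_of_real x)))}"

definition L2_norm_sq :: "(complex \<Rightarrow> complex) \<Rightarrow> ennreal" where
  "L2_norm_sq F = (\<integral>\<^sup>+ x. ennreal ((norm (F (complex_of_real x)))\<^sup>2) \<partial>lborel)"

definition sample_map :: "(complex \<Rightarrow> complex) \<Rightarrow> int \<Rightarrow> complex" where
  "sample_map F n = (if n \<ge> 0 then F (of_int n)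
                     else - (1 / (2 * complex_of_real pi * \<i>)) * deriv F (of_int n))"

definition sample_norm_sq :: "(complex \<Rightarrow> complex) \<Rightarrow> ennreal" where
  "sample_norm_sq F = (\<Sum>\<^sub>\<infinity> n::int. ennreal ((norm (sample_map F n))\<^sup>2))"

end

theory Submission
  imports Defs
begin

text \<open>
  Put \<open>F(\<xi>) = \<integral> f(x) e(-\<xi>x) dx\<close> over \<open>[-1/2, 1/2]\<close>, where \<open>e(t) = exp (2\<pi>it)\<close>. The samples of \<open>F\<close> are the
  Fourier coefficients of \<open>f\<close> at \<open>n \<ge> 0\<close> and those of \<open>x f\<close> at \<open>n < 0\<close>.

  Injectivity: if all samples vanish, then \<open>x f\<close> has spectrum in \<open>n \<ge> 0\<close> and \<open>e(-x) f\<close> has spectrum in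
  \<open>n < -1\<close>, so they are orthogonal: \<open>\<integral> x |f|\<^sup>2 e(x) dx = 0\<close>. The imaginary part is
  \<open>\<integral> x sin(2\<pi>x) |f|\<^sup>2 dx\<close>, whose weight is positive almost everywhere on the interval, hence \<open>f = 0\<close>.

  Instability: the Dirichlet sum \<open>f = e(-x) + \<dots> + e(-Nx)\<close> has no coefficients at \<open>n \<ge> 0\<close>, and \<open>x f\<close> is
  bounded uniformly in \<open>N\<close>, so by Bessel's inequality its samples are bounded in \<open>\<ell>\<^sup>2\<close>. The bound on \<open>x f\<close>
  also makes \<open>F\<close> Lipschitz uniformly in \<open>N\<close>; as \<open>F(-k) = 1\<close> for \<open>1 \<le> k \<le> N\<close>, the norm of \<open>F\<close> is unbounded.
\<close>

section \<open>Square-integrable functions and Fourier coefficients\<close>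

text \<open>The completed Lebesgue measure is used so that gauge integration and
  \<open>measurable_on\<close> apply without transfer. The interval has mass 1, which makes the
  characters orthonormal. Its end points are distinct points, so periodicity has to be arranged
  separately.\<close>

definition torus :: "real measure" where
  "torus = lebesgue_on {-1/2..1/2}"

definition chr :: "int \<Rightarrow> real \<Rightarrow> complex" where
  "chr n x = cis (2 * pi * of_int n * x)"

definition fcoeff :: "(real \<Rightarrow> complex) \<Rightarrow> int \<Rightarrow> complex" where
  "fcoeff f n = (LINT x|torus. f x * cnj (chr n x))"

definition sq_int :: "(real \<Rightarrow> complex) \<Rightarrow> bool" where
  "sq_int f \<longleftrightarrow> f \<in> borel_measurable torus \<and> integrable torus (\<lambda>x. (cmod (f x))\<^sup>2)"

definition nsq :: "(real \<Rightarrow> complex) \<Rightarrow> real" where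
  "nsq f = (LINT x|torus. (cmod (f x))\<^sup>2)"

lemma space_torus [simp]: "space torus = {-1/2..1/2}"
  by (simp add: torus_def)

lemma emeasure_torus [simp]: "emeasure torus {-1/2..1/2} = 1"
  by (simp add: torus_def emeasure_restrict_space)

lemma measure_torus [simp]: "measure torus {-1/2..1/2} = 1"
  by (simp add: measure_def del: divide_minus_left)

interpretation torus: finite_measure torus
  by (rule finite_measureI) (simp del: divide_minus_left)

lemma continuous_imp_measurable_torus:
  fixes f :: "real \<Rightarrow> 'a::euclidean_space"
  shows "continuous_on UNIV f \<Longrightarrow> f \<in> borel_measurable torus"
  unfolding torus_def
  by (rule measurable_restrict_space1, rule measurable_completion)
     (simp add: borel_measurable_continuous_onI)

lemma norm_chr [simp]: "cmod (chr n x) = 1"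
  by (simp add: chr_def)

lemma chr_0 [simp]: "chr 0 x = 1"
  by (simp add: chr_def)

lemma chr_mult: "chr m x * chr n x = chr (m + n) x"
  by (simp add: chr_def cis_mult algebra_simps)

lemma cnj_chr: "cnj (chr n x) = chr (- n) x"
  by (simp add: chr_def cis_cnj)

lemma continuous_chr [continuous_intros]: "continuous_on S (chr n)"
  unfolding chr_def by (intro continuous_intros)

lemma measurable_chr [measurable]: "chr n \<in> borel_measurable torus"
  by (intro continuous_imp_measurable_torus continuous_chr)

lemma sq_int_measurable [measurable_dest]: "sq_int f \<Longrightarrow> f \<in> borel_measurable torus"
  by (simp add: sq_int_def)

lemma sq_int_bounded:
  assumes "f \<in> borel_measurable torus" "\<And>x. x \<in> {-1/2..1/2} \<Longrightarrow> cmod (f x) \<le> B"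
  shows "sq_int f"
proof -
  have "integrable torus (\<lambda>x. (cmod (f x))\<^sup>2)"
    by (rule torus.integrable_const_bound[where B="B\<^sup>2"])
       (use assms in \<open>auto intro!: AE_I2 power_mono\<close>)
  then show ?thesis using assms by (simp add: sq_int_def)
qed

lemma sq_int_chr [simp]: "sq_int (chr n)"
  by (rule sq_int_bounded[where B=1]) auto

lemma sq_int_mult_bounded:
  assumes f: "sq_int f" and [measurable]: "b \<in> borel_measurable torus"
    and B: "\<And>x. x \<in> {-1/2..1/2} \<Longrightarrow> cmod (b x) \<le> B"
  shows "sq_int (\<lambda>x. b x * f x)"
proof -
  note [measurable] = sq_int_measurable[OF f]
  have "integrable torus (\<lambda>x. (cmod (b x * f x))\<^sup>2)"
  proof (rule Bochner_Integration.integrable_bound)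
    show "integrable torus (\<lambda>x. B\<^sup>2 * (cmod (f x))\<^sup>2)"
      using f by (simp add: sq_int_def)
    show "AE x in torus. norm ((cmod (b x * f x))\<^sup>2) \<le> norm (B\<^sup>2 * (cmod (f x))\<^sup>2)"
      by (rule AE_I2) (use B in \<open>auto simp: norm_mult power_mult_distrib intro!: mult_right_mono power_mono\<close>)
  qed measurable
  then show ?thesis by (simp add: sq_int_def)
qed

lemma sq_int_cmult: "sq_int f \<Longrightarrow> sq_int (\<lambda>x. c * f x)"
  by (rule sq_int_mult_bounded[where B="cmod c"]) auto

lemma norm_add_sq_le: "(cmod (a + b))\<^sup>2 \<le> 2 * (cmod a)\<^sup>2 + 2 * (cmod b)\<^sup>2"
proof -
  have "(cmod (a + b))\<^sup>2 \<le> (cmod a + cmod b)\<^sup>2"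
    by (intro power_mono norm_triangle_ineq) auto
  also have "\<dots> \<le> 2 * (cmod a)\<^sup>2 + 2 * (cmod b)\<^sup>2"
    using sum_squares_bound[of "cmod a" "cmod b"] by (simp add: power2_sum)
  finally show ?thesis .
qed

lemma sq_int_add:
  assumes f: "sq_int f" and g: "sq_int g"
  shows "sq_int (\<lambda>x. f x + g x)"
proof -
  note [measurable] = sq_int_measurable[OF f] sq_int_measurable[OF g]
  have "integrable torus (\<lambda>x. (cmod (f x + g x))\<^sup>2)"
  proof (rule Bochner_Integration.integrable_bound)
    show "integrable torus (\<lambda>x. 2 * (cmod (f x))\<^sup>2 + 2 * (cmod (g x))\<^sup>2)"
      using f g by (simp add: sq_int_def)
    show "AE x in torus. norm ((cmod (f x + g x))\<^sup>2) \<le> norm (2 * (cmod (f x))\<^sup>2 + 2 * (cmod (g x))\<^sup>2)"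
      by (rule AE_I2) (use norm_add_sq_le in auto)
  qed measurable
  then show ?thesis by (simp add: sq_int_def)
qed

lemma sq_int_diff: "sq_int f \<Longrightarrow> sq_int g \<Longrightarrow> sq_int (\<lambda>x. f x - g x)"
  using sq_int_add[of f "\<lambda>x. (-1) * g x"] sq_int_cmult[of g "-1"] by simp

lemma sq_int_sum: "(\<And>i. i \<in> S \<Longrightarrow> sq_int (f i)) \<Longrightarrow> sq_int (\<lambda>x. \<Sum>i\<in>S. f i x)"
proof (induction S rule: infinite_finite_induct)
  case (insert i S)
  then show ?case by (simp add: sq_int_add)
qed (simp_all add: sq_int_def)

section \<open>Square-root-free substitutes for the triangle and Cauchy-Schwarz inequalities\<close>

lemma nsq_nonneg: "nsq f \<ge> 0"
  by (simp add: nsq_def)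

lemma nsq_add_le:
  assumes f: "sq_int f" and g: "sq_int g"
  shows "nsq (\<lambda>x. f x + g x) \<le> 2 * nsq f + 2 * nsq g"
proof -
  have "nsq (\<lambda>x. f x + g x) \<le> (LINT x|torus. 2 * (cmod (f x))\<^sup>2 + 2 * (cmod (g x))\<^sup>2)"
    unfolding nsq_def
    by (rule integral_mono) (use f g sq_int_add[OF f g] norm_add_sq_le in \<open>auto simp: sq_int_def\<close>)
  also have "\<dots> = 2 * nsq f + 2 * nsq g"
    using f g by (simp add: nsq_def sq_int_def)
  finally show ?thesis .
qed

text \<open>AM-GM for the rescaled factors \<open>p\<close> and \<open>q\<close>: their product is
  nonnegative, hence at most 2pq, which is at most the sum of the squares. The free weight
  \<open>t\<close> lets one of the two terms be made small at the expense of the other.\<close>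

lemma norm_mult_weighted_le:
  assumes "t > 0"
  shows "cmod (a * b) \<le> t * (cmod a)\<^sup>2 + (cmod b)\<^sup>2 / t"
proof -
  define p where "p = sqrt t * cmod a"
  define q where "q = cmod b / sqrt t"
  have "p * q = cmod (a * b)" "p\<^sup>2 = t * (cmod a)\<^sup>2" "q\<^sup>2 = (cmod b)\<^sup>2 / t"
    using assms by (auto simp: p_def q_def norm_mult power_mult_distrib power_divide)
  moreover have "p \<ge> 0" "q \<ge> 0" using assms by (auto simp: p_def q_def)
  ultimately show ?thesis
    using sum_squares_bound[of p q] mult_nonneg_nonneg[of p q] by linarith
qed

lemma integrable_mult_sq_int:
  assumes f: "sq_int f" and g: "sq_int g"
  shows "integrable torus (\<lambda>x. f x * g x)"
proof (rule Bochner_Integration.integrable_bound)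
  note [measurable] = sq_int_measurable[OF f] sq_int_measurable[OF g]
  show "integrable torus (\<lambda>x. (cmod (f x))\<^sup>2 + (cmod (g x))\<^sup>2)"
    using f g by (simp add: sq_int_def)
  show "AE x in torus. norm (f x * g x) \<le> norm ((cmod (f x))\<^sup>2 + (cmod (g x))\<^sup>2)"
    by (rule AE_I2) (use norm_mult_weighted_le[of 1] in \<open>auto\<close>)
  show "(\<lambda>x. f x * g x) \<in> borel_measurable torus" by measurable
qed

lemma sq_int_cnj: "sq_int f \<Longrightarrow> sq_int (\<lambda>x. cnj (f x))"
  using measurable_compose[of f torus borel cnj borel]
  by (simp add: sq_int_def borel_measurable_continuous_onI continuous_on_cnj)

text \<open>This takes the place of Cauchy-Schwarz: with \<open>t\<close> large the term in
  \<open>nsq g\<close> becomes small, and a good approximation then controls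
  \<open>t * nsq f\<close>.\<close>

lemma norm_integral_mult_le:
  assumes f: "sq_int f" and g: "sq_int g" and t: "t > 0"
  shows "cmod (LINT x|torus. f x * g x) \<le> t * nsq f + nsq g / t"
proof -
  have "cmod (LINT x|torus. f x * g x) \<le> (LINT x|torus. cmod (f x * g x))"
    by (rule integral_norm_bound)
  also have "\<dots> \<le> (LINT x|torus. t * (cmod (f x))\<^sup>2 + (cmod (g x))\<^sup>2 / t)"
    by (rule integral_mono)
       (use f g t norm_mult_weighted_le integrable_mult_sq_int[OF f g] in \<open>auto simp: sq_int_def\<close>)
  also have "\<dots> = t * nsq f + nsq g / t"
    using f g by (simp add: nsq_def sq_int_def)
  finally show ?thesis .
qed

section \<open>Orthonormality of the characters, Bessel's inequality and best approximation\<close>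

lemma integral_chr: "(LINT x|torus. chr n x) = (if n = 0 then 1 else 0)"
proof (cases "n = 0")
  case True
  then show ?thesis by (simp del: divide_minus_left)
next
  case False
  \<comment> \<open>A primitive of the character; it takes equal values at the two end points
    because they differ by a full period.\<close>
  define F where "F x = chr n x / (2 * pi * of_int n * \<i>)" for x
  have "(chr n has_integral (F (1/2) - F (-1/2))) {-1/2..1/2}"
  proof (rule fundamental_theorem_of_calculus)
    fix x :: real assume "x \<in> {-1/2..1/2}"
    have "((\<lambda>x. exp (2 * pi * of_int n * \<i> * of_real x)) has_vector_derivative
        exp (2 * pi * of_int n * \<i> * of_real x) * (2 * pi * of_int n * \<i>)) (at x within {-1/2..1/2})"
      by (rule has_vector_derivative_real_field) (auto intro!: derivative_eq_intros)
    then have "((\<lambda>x. exp (2 * pi * of_int n * \<i> * of_real x) / (2 * pi * of_int n * \<i>)) has_vector_derivative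
        exp (2 * pi * of_int n * \<i> * of_real x) * (2 * pi * of_int n * \<i>) / (2 * pi * of_int n * \<i>)) (at x within {-1/2..1/2})"
      by (rule has_vector_derivative_divide)
    moreover have "chr n x = exp (2 * pi * of_int n * \<i> * of_real x)" for x
      by (simp add: chr_def cis_conv_exp mult_ac)
    ultimately show "(F has_vector_derivative chr n x) (at x within {-1/2..1/2})"
      using False by (simp add: F_def[abs_def])
  qed simp
  moreover have "F (1/2) = F (-1/2)"
  proof -
    have "chr n (1/2) = chr n (-1/2) * cis (2 * pi * of_int n)"
      unfolding chr_def cis_mult by (simp add: algebra_simps)
    then show ?thesis by (simp add: F_def)
  qed
  ultimately have "(chr n has_integral 0) {-1/2..1/2}" by simp
  then have "integral {-1/2..1/2} (chr n) = 0" by (rule integral_unique)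
  moreover have "integrable torus (chr n)"
    by (rule torus.integrable_const_bound[where B=1]) auto
  ultimately show ?thesis
    using False unfolding torus_def by (subst lebesgue_integral_eq_integral) auto
qed

lemma fcoeff_chr: "fcoeff (chr m) n = (if m = n then 1 else 0)"
  by (simp add: fcoeff_def cnj_chr chr_mult integral_chr)

lemma integrable_fcoeff: "sq_int f \<Longrightarrow> integrable torus (\<lambda>x. f x * cnj (chr n x))"
  by (intro integrable_mult_sq_int sq_int_cnj) auto

lemma fcoeff_cmult: "fcoeff (\<lambda>x. c * f x) n = c * fcoeff f n"
  by (simp add: fcoeff_def mult.assoc)

lemma fcoeff_diff: "sq_int f \<Longrightarrow> sq_int g \<Longrightarrow> fcoeff (\<lambda>x. f x - g x) n = fcoeff f n - fcoeff g n"
  by (simp add: fcoeff_def left_diff_distrib integrable_fcoeff)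

lemma fcoeff_sum:
  "(\<And>i. i \<in> S \<Longrightarrow> sq_int (f i)) \<Longrightarrow> fcoeff (\<lambda>x. \<Sum>i\<in>S. f i x) n = (\<Sum>i\<in>S. fcoeff (f i) n)"
  by (simp add: fcoeff_def sum_distrib_right integrable_fcoeff)

lemma nsq_diff_chr:
  assumes u: "sq_int u"
  shows "nsq (\<lambda>x. u x - c * chr m x) = nsq u - 2 * Re (cnj c * fcoeff u m) + (cmod c)\<^sup>2"
proof -
  have *: "(cmod (u x - c * chr m x))\<^sup>2
      = (cmod (u x))\<^sup>2 - 2 * Re (cnj c * (u x * cnj (chr m x))) + (cmod c)\<^sup>2" for x
  proof -
    have "(cmod (u x - c * chr m x))\<^sup>2 = (cmod (u x))\<^sup>2 + (cmod (c * chr m x))\<^sup>2 - 2 * Re (u x * cnj (c * chr m x))"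
      unfolding cmod_power2 by (simp add: power2_eq_square algebra_simps)
    then show ?thesis by (simp add: norm_mult mult_ac)
  qed
  define r where "r x = Re (cnj c * (u x * cnj (chr m x)))" for x
  have i: "integrable torus r"
    unfolding r_def
    using integrable_fcoeff[OF u] by (intro integrable_Re integrable_mult_right)
  have "(LINT x|torus. r x) = Re (LINT x|torus. cnj c * (u x * cnj (chr m x)))"
    unfolding r_def using integrable_fcoeff[OF u] by (intro integral_Re integrable_mult_right)
  also have "\<dots> = Re (cnj c * fcoeff u m)" by (simp add: fcoeff_def)
  finally have "(LINT x|torus. r x) = Re (cnj c * fcoeff u m)" .
  then show ?thesis
    unfolding nsq_def * r_def[symmetric] using i u by (simp add: sq_int_def del: divide_minus_left)
qed

text \<open>By orthonormality the characters can be subtracted one at a time, each contributing its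
  own term. Bessel's inequality and best approximation are both read off from this identity.\<close>

lemma nsq_diff_sum_chr:
  assumes f: "sq_int f" and "finite S"
  shows "nsq (\<lambda>x. f x - (\<Sum>n\<in>S. c n * chr n x))
       = nsq f + (\<Sum>n\<in>S. (cmod (c n))\<^sup>2 - 2 * Re (cnj (c n) * fcoeff f n))"
  using \<open>finite S\<close>
proof (induction S)
  case empty
  then show ?case by simp
next
  case (insert m S)
  let ?u = "\<lambda>x. f x - (\<Sum>n\<in>S. c n * chr n x)"
  have s: "sq_int (\<lambda>x. \<Sum>n\<in>S. c n * chr n x)"
    by (intro sq_int_sum sq_int_cmult sq_int_chr)
  have u: "sq_int ?u" by (intro sq_int_diff f s)
  \<comment> \<open>The characters already removed have indices other than \<open>m\<close>, so the
    remainder keeps the coefficient of \<open>f\<close> at \<open>m\<close>.\<close>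
  have "fcoeff ?u m = fcoeff f m - (\<Sum>n\<in>S. c n * fcoeff (chr n) m)"
    by (simp add: fcoeff_diff f s fcoeff_sum sq_int_cmult fcoeff_cmult)
  also have "(\<Sum>n\<in>S. c n * fcoeff (chr n) m) = 0"
    using insert.hyps by (intro sum.neutral) (auto simp: fcoeff_chr)
  finally have "fcoeff ?u m = fcoeff f m" by simp
  then have "nsq (\<lambda>x. ?u x - c m * chr m x) = nsq ?u - 2 * Re (cnj (c m) * fcoeff f m) + (cmod (c m))\<^sup>2"
    using nsq_diff_chr[OF u] by simp
  then show ?case
    using insert by (simp add: algebra_simps)
qed

lemma nsq_diff_fourier_sum:
  assumes f: "sq_int f" and "finite S"
  shows "nsq (\<lambda>x. f x - (\<Sum>n\<in>S. fcoeff f n * chr n x)) = nsq f - (\<Sum>n\<in>S. (cmod (fcoeff f n))\<^sup>2)"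
proof -
  have "Re (cnj z * z) = (cmod z)\<^sup>2" for z
    by (metis Re_complex_of_real complex_norm_square mult.commute)
  then show ?thesis
    by (simp only: nsq_diff_sum_chr[OF assms]) (simp add: sum_negf)
qed

lemma Bessel_inequality:
  assumes "sq_int f" "finite S"
  shows "(\<Sum>n\<in>S. (cmod (fcoeff f n))\<^sup>2) \<le> nsq f"
  using nsq_nonneg nsq_diff_fourier_sum[OF assms] by (metis diff_ge_0_iff_ge)

text \<open>Completing the square in each summand: the excess over the Fourier choice is the squared
  modulus of \<open>fcoeff f n - c n\<close>.\<close>

lemma fourier_sum_best_approximation:
  assumes "sq_int f" "finite S"
  shows "nsq (\<lambda>x. f x - (\<Sum>n\<in>S. fcoeff f n * chr n x)) \<le> nsq (\<lambda>x. f x - (\<Sum>n\<in>S. c n * chr n x))"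
proof -
  have "- ((cmod z)\<^sup>2) \<le> (cmod w)\<^sup>2 - 2 * Re (cnj w * z)" for w z
  proof -
    have "0 \<le> (cmod (z - w))\<^sup>2" by simp
    also have "\<dots> = (cmod z)\<^sup>2 + (cmod w)\<^sup>2 - 2 * Re (cnj w * z)"
      unfolding cmod_power2 by (simp add: power2_eq_square algebra_simps)
    finally show ?thesis by simp
  qed
  then have "(\<Sum>n\<in>S. - ((cmod (fcoeff f n))\<^sup>2)) \<le> (\<Sum>n\<in>S. (cmod (c n))\<^sup>2 - 2 * Re (cnj (c n) * fcoeff f n))"
    by (intro sum_mono)
  then show ?thesis
    unfolding nsq_diff_fourier_sum[OF assms] nsq_diff_sum_chr[OF assms] by (simp add: sum_negf)
qed

section \<open>Density of trigonometric polynomials\<close>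

text \<open>The inductive form makes closure under sums and products provable by induction. Repeated
  frequencies are allowed here and are merged in \<open>trig_poly_imp_sum\<close>.\<close>

inductive trig_poly :: "(real \<Rightarrow> complex) \<Rightarrow> bool" where
  zero: "trig_poly (\<lambda>x. 0)"
| add_chr: "trig_poly p \<Longrightarrow> trig_poly (\<lambda>x. c * chr n x + p x)"

lemma trig_poly_chr: "trig_poly (\<lambda>x. c * chr n x)"
  using trig_poly.add_chr[OF trig_poly.zero] by simp

lemma trig_poly_const: "trig_poly (\<lambda>x. c)"
  using trig_poly_chr[of c 0] by simp

lemma trig_poly_add: "trig_poly p \<Longrightarrow> trig_poly q \<Longrightarrow> trig_poly (\<lambda>x. p x + q x)"
proof (induction rule: trig_poly.induct)
  case (add_chr p c n)
  then show ?case using trig_poly.add_chr[of "\<lambda>x. p x + q x" c n] by (simp add: add.assoc)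
qed simp

lemma trig_poly_chr_mult: "trig_poly p \<Longrightarrow> trig_poly (\<lambda>x. c * chr n x * p x)"
proof (induction rule: trig_poly.induct)
  case zero
  then show ?case by (simp add: trig_poly.zero)
next
  case (add_chr p d m)
  have "c * chr n x * (d * chr m x + p x) = c * d * chr (n + m) x + c * chr n x * p x" for x
    by (simp add: chr_mult[symmetric] algebra_simps)
  then show ?case using trig_poly.add_chr[OF add_chr.IH, of "c * d" "n + m"] by simp
qed

lemma trig_poly_mult: "trig_poly p \<Longrightarrow> trig_poly q \<Longrightarrow> trig_poly (\<lambda>x. p x * q x)"
proof (induction rule: trig_poly.induct)
  case zero
  then show ?case by (simp add: trig_poly.zero)
next
  case (add_chr p c n)
  then show ?case
    using trig_poly_add[OF trig_poly_chr_mult[of q c n]] by (simp add: distrib_right)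
qed

lemma trig_poly_imp_sum:
  "trig_poly p \<Longrightarrow> \<exists>S c. finite S \<and> p = (\<lambda>x. \<Sum>n\<in>S. c n * chr n x)"
proof (induction rule: trig_poly.induct)
  case zero
  then show ?case by (intro exI[of _ "{}"]) simp
next
  case (add_chr p a m)
  then obtain S c where S: "finite S" "p = (\<lambda>x. \<Sum>n\<in>S. c n * chr n x)" by blast
  \<comment> \<open>The two conditionals also cover the case that \<open>m\<close> already lies in
    \<open>S\<close>, where the coefficients have to be added.\<close>
  define c' where "c' n = (if n = m then a else 0) + (if n \<in> S then c n else 0)" for n
  have "(\<Sum>n\<in>insert m S. c' n * chr n x)
      = (\<Sum>n\<in>insert m S. if n = m then a * chr n x else 0)
        + (\<Sum>n\<in>insert m S. if n \<in> S then c n * chr n x else 0)" for x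
    unfolding sum.distrib[symmetric] by (rule sum.cong) (auto simp: c'_def algebra_simps)
  also have "\<dots> x = a * chr m x + p x" for x
    using S by (simp add: sum.inter_restrict[symmetric] insert_absorb Int_absorb1 subset_insertI)
  finally show ?case
    using S by (intro exI[of _ "insert m S"] exI[of _ c']) auto
qed

text \<open>A real-linear functional on the complex plane is a combination of z and its conjugate.
  On the circle these are \<open>chr 1\<close> and \<open>chr (-1)\<close>; sums and products follow
  by closure.\<close>

lemma trig_poly_real_polynomial_function:
  fixes g :: "complex \<Rightarrow> real"
  assumes "real_polynomial_function g"
  shows "trig_poly (\<lambda>x. of_real (g (chr 1 x)))"
  using assms
proof (induction rule: real_polynomial_function.induct)
  case (linear f)
  have "of_real (f (chr 1 x)) = ((of_real (f 1) - \<i> * of_real (f \<i>)) / 2) * chr 1 x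
        + ((of_real (f 1) + \<i> * of_real (f \<i>)) / 2) * chr (-1) x" for x
  proof -
    interpret f: bounded_linear f by (rule linear)
    define z where "z = chr 1 x"
    have "f z = f (Re z *\<^sub>R 1 + Im z *\<^sub>R \<i>)"
      by (rule arg_cong[of _ _ f]) (simp add: complex_eq_iff)
    then have "f z = Re z * f 1 + Im z * f \<i>"
      by (simp only: f.add f.scaleR real_scaleR_def)
    then show ?thesis
      unfolding cnj_chr[of 1, symmetric] z_def[symmetric] by (simp add: complex_eq_iff field_simps)
  qed
  then show ?case
    by (simp only: trig_poly_add[OF trig_poly_chr trig_poly_chr])
next
  case (const c)
  then show ?case by (rule trig_poly_const)
next
  case (add f g)
  then show ?case using trig_poly_add by simp
next
  case (mult f g)
  then show ?case using trig_poly_mult by simp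
qed

lemma trig_poly_polynomial_function:
  fixes g :: "complex \<Rightarrow> complex"
  assumes "polynomial_function g"
  shows "trig_poly (\<lambda>x. g (chr 1 x))"
proof -
  have "real_polynomial_function (Re \<circ> g)" "real_polynomial_function (Im \<circ> g)"
    using assms bounded_linear_Re bounded_linear_Im unfolding polynomial_function_def by blast+
  from this[THEN trig_poly_real_polynomial_function]
  \<comment> \<open>The factor \<open>chr 0 x\<close>, which is 1, puts the multiplication by
    \<open>\<i>\<close> into the shape of \<open>trig_poly_chr_mult\<close>.\<close>
  have "trig_poly (\<lambda>x. of_real ((Re \<circ> g) (chr 1 x)) + \<i> * chr 0 x * of_real ((Im \<circ> g) (chr 1 x)))"
    by (intro trig_poly_add trig_poly_chr_mult)
  moreover have "of_real ((Re \<circ> g) z) + \<i> * chr 0 x * of_real ((Im \<circ> g) z) = g z" for x z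
    by (simp add: complex_eq_iff)
  ultimately show ?thesis by simp
qed

lemma chr_1_image: "chr 1 ` {-1/2..1/2} = sphere 0 1"
proof
  show "sphere 0 1 \<subseteq> chr 1 ` {-1/2..1/2}"
  proof
    fix z :: complex assume "z \<in> sphere 0 1"
    then have z: "cmod z = 1" by simp
    then have "z = cis (Arg z)" using cis_Arg[of z] by (cases "z = 0") (auto simp: sgn_div_norm)
    then have "z = chr 1 (Arg z / (2 * pi))" by (simp add: chr_def)
    moreover have "Arg z / (2 * pi) \<in> {-1/2..1/2}"
      using Arg_bounded[of z] by (auto simp: field_simps)
    ultimately show "z \<in> chr 1 ` {-1/2..1/2}" by blast
  qed
qed auto

text \<open>Equal values force y - x to be a positive integer, and in an interval of length 1 only
  the two end points are that far apart.\<close>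

lemma chr_1_eq_cases:
  assumes "chr 1 x = chr 1 y" "x \<in> {-1/2..1/2}" "y \<in> {-1/2..1/2}" "x < y"
  shows "x = -1/2 \<and> y = 1/2"
proof -
  have "cis (2 * pi * x) = cis (2 * pi * y)" using assms by (simp add: chr_def)
  then have "cis (2 * pi * y - 2 * pi * x) = 1" by (simp add: cis_divide[symmetric])
  then have "cos (2 * pi * (y - x)) = 1"
    by (metis Re_complex_of_real cis.simps(1) of_real_1 right_diff_distrib)
  then obtain k :: int where "2 * pi * (y - x) = of_int k * 2 * pi"
    using cos_one_2pi_int by blast
  then have k: "y - x = of_int k" by simp
  have "k > 0" using k assms(4) by (metis diff_gt_0_iff_gt of_int_0_less_iff)
  then have "real_of_int k \<ge> 1" by simp
  then have "y - x \<ge> 1" using k by simp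
  then show ?thesis using assms(2,3) unfolding atLeastAtMost_iff by linarith
qed

text \<open>A continuous function with equal end values factors through the quotient map onto the unit circle,
  where polynomials in the real and imaginary parts become trigonometric polynomials.\<close>

lemma trig_approx_continuous:
  assumes cont: "continuous_on {-1/2..1/2} \<phi>" and ends: "\<phi> (-1/2) = \<phi> (1/2)" and "e > 0"
  obtains p where "trig_poly p" "\<And>x. x \<in> {-1/2..1/2} \<Longrightarrow> cmod (\<phi> x - p x) < e"
proof -
  let ?I = "{-1/2..1/2::real}"
  \<comment> \<open>The function induced on the circle. Only the point -1 has two preimages, and
    \<open>ends\<close> makes the choice between them irrelevant.\<close>
  define \<psi> where "\<psi> z = \<phi> (inv_into ?I (chr 1) z)" for z
  have \<psi>: "\<psi> (chr 1 x) = \<phi> x" if "x \<in> ?I" for x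
  proof -
    define y where "y = inv_into ?I (chr 1) (chr 1 x)"
    have "y \<in> ?I" "chr 1 y = chr 1 x"
      unfolding y_def using that by (auto intro: inv_into_into f_inv_into_f simp del: atLeastAtMost_iff)
    then have "x = y \<or> (x = -1/2 \<and> y = 1/2) \<or> (y = -1/2 \<and> x = 1/2)"
      using that chr_1_eq_cases[of x y] chr_1_eq_cases[of y x] by (cases x y rule: linorder_cases) auto
    then have "\<phi> y = \<phi> x" using ends by metis
    then show ?thesis by (simp only: \<psi>_def y_def)
  qed
  \<comment> \<open>A continuous surjection from a compact space onto a Hausdorff space is a
    quotient map.\<close>
  have "quotient_map (top_of_set ?I) (top_of_set (sphere 0 1)) (chr 1)"
    by (rule T1_Spaces.continuous_imp_quotient_map)
       (use chr_1_image in \<open>auto simp: continuous_chr compact_space_subtopology Hausdorff_space_subtopology\<close>)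
  moreover have "continuous_map (top_of_set ?I) euclidean (\<psi> \<circ> chr 1)"
    using cont \<psi> by (simp del: atLeastAtMost_iff divide_minus_left cong: continuous_on_cong)
  ultimately have "continuous_map (top_of_set (sphere 0 1)) euclidean \<psi>"
    by (rule continuous_compose_quotient_map)
  then have "continuous_on (sphere 0 1) \<psi>" by simp
  with \<open>e > 0\<close> obtain g where g: "polynomial_function g"
      and less: "\<And>z. z \<in> sphere 0 1 \<Longrightarrow> cmod (\<psi> z - g z) < e"
    using Stone_Weierstrass_polynomial_function[of "sphere 0 1" \<psi> e] by auto
  show thesis
  proof (rule that)
    show "trig_poly (\<lambda>x. g (chr 1 x))" using g by (rule trig_poly_polynomial_function)
    show "cmod (\<phi> x - g (chr 1 x)) < e" if "x \<in> ?I" for x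
      using less[of "chr 1 x"] \<psi>[OF that] by simp
  qed
qed

lemma sq_int_trig_poly:
  assumes "trig_poly p"
  shows "sq_int p"
proof -
  obtain S c where "p = (\<lambda>x. \<Sum>n\<in>S. c n * chr n x)"
    using trig_poly_imp_sum[OF assms] by blast
  then show ?thesis by (simp add: sq_int_sum sq_int_cmult)
qed

section \<open>Approximation in mean square\<close>

lemma AE_torus_not_in:
  assumes "negligible N"
  shows "AE x in torus. x \<notin> N"
proof -
  have "AE x in lebesgue. x \<notin> N"
    by (rule AE_I'[of N]) (use assms in \<open>auto simp: negligible_iff_null_sets\<close>)
  then show ?thesis
    unfolding torus_def by (subst AE_restrict_space_iff) (auto elim: eventually_mono)
qed

text \<open>Measurability supplies continuous functions converging to \<open>f\<close> almost
  everywhere. Once they are bounded and periodic, dominated convergence gives closeness in mean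
  square, and uniform approximation on the circle finishes.\<close>

lemma trig_poly_dense_bounded:
  assumes f: "f \<in> borel_measurable torus" and B: "\<And>x. cmod (f x) \<le> B" and "B > 0" and "e > 0"
  obtains p where "trig_poly p" "nsq (\<lambda>x. f x - p x) < e"
proof -
  let ?I = "{-1/2..1/2::real}"
  have "f measurable_on ?I"
    using f unfolding torus_def by (subst measurable_on_iff_borel_measurable) auto
  then obtain N g where N: "negligible N" and g: "\<And>n::nat. continuous_on UNIV (g n)"
    and lim: "\<And>x. x \<notin> N \<Longrightarrow> (\<lambda>n. g n x) \<longlonglongrightarrow> (if x \<in> ?I then f x else 0)"
    unfolding measurable_on_def by blast
  \<comment> \<open>Radial projection to the disc of radius \<open>B\<close> dominates the approximants, and a cut-off at the end points
    makes them periodic.\<close>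
  define K where "K z = of_real (B / max B (cmod z)) * z" for z
  have max_pos: "max B r > 0" for r using \<open>B > 0\<close> by (simp add: less_max_iff_disj)
  then have max_nz: "max B r \<noteq> 0" for r by (metis less_irrefl)
  have contK: "continuous_on UNIV K"
    unfolding K_def by (intro continuous_intros) (use max_nz in auto)
  have normK: "cmod (K z) \<le> B" for z
  proof -
    have "cmod (K z) = B * (cmod z / max B (cmod z))"
      using max_pos[of "cmod z"] \<open>B > 0\<close> by (simp add: K_def norm_mult norm_divide)
    also have "\<dots> \<le> B * 1"
      by (intro mult_left_mono) (use max_pos[of "cmod z"] \<open>B > 0\<close> in \<open>auto simp: divide_le_eq\<close>)
    finally show ?thesis by simp
  qed
  have Kf: "K (f x) = f x" for x
    using B[of x] \<open>B > 0\<close> by (simp add: K_def max_def)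
  define cut where "cut n x = min 1 (real n * \<bar>1/2 - \<bar>x\<bar>\<bar>)" for n x
  define \<psi> where "\<psi> n x = of_real (cut n x) * K (g n x)" for n x
  have cont\<psi>: "continuous_on UNIV (\<psi> n)" for n
    unfolding \<psi>_def cut_def by (intro continuous_intros continuous_on_compose2[OF contK g]) auto
  then have [measurable]: "\<psi> n \<in> borel_measurable torus" for n
    by (rule continuous_imp_measurable_torus)
  note [measurable] = f
  have norm\<psi>: "cmod (\<psi> n x) \<le> B" for n x
  proof -
    have "cmod (\<psi> n x) \<le> 1 * B"
      unfolding \<psi>_def norm_mult by (intro mult_mono normK) (auto simp: cut_def)
    then show ?thesis by simp
  qed
  have sf: "sq_int f" by (rule sq_int_bounded[OF f, of B]) (rule B)
  have s\<psi>: "sq_int (\<psi> n)" for n by (rule sq_int_bounded[of _ B]) (auto intro: norm\<psi>)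
  have lim\<psi>: "AE x in torus. (\<lambda>n. \<psi> n x) \<longlonglongrightarrow> f x"
  proof -
    \<comment> \<open>The end points join the exceptional set because the cut-off is 0 there for
      every \<open>n\<close>.\<close>
    have "AE x in torus. x \<notin> N \<union> {-1/2, 1/2}"
      by (rule AE_torus_not_in) (use N in auto)
    moreover have "AE x in torus. x \<in> ?I" by (rule AE_I2) simp
    ultimately show ?thesis
    proof eventually_elim
      fix x assume x: "x \<notin> N \<union> {-1/2, 1/2}" "x \<in> ?I"
      have "(\<lambda>n. g n x) \<longlonglongrightarrow> f x" using lim[of x] x by auto
      then have "(\<lambda>n. K (g n x)) \<longlonglongrightarrow> K (f x)"
        using contK by (intro isCont_tendsto_compose[of _ K]) (auto simp: continuous_on_eq_continuous_at)
      moreover have "(\<lambda>n. of_real (cut n x)) \<longlonglongrightarrow> (1::complex)"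
      proof (rule tendsto_eventually)
        define d where "d = \<bar>1/2 - \<bar>x\<bar>\<bar>"
        have "d > 0" using x by (auto simp: d_def)
        obtain n0 :: nat where "1 / d < n0" using reals_Archimedean2 by blast
        then have "cut n x = 1" if "n \<ge> n0" for n
        proof -
          have "1 / d \<le> real n" using that \<open>1 / d < n0\<close> by linarith
          then have "1 \<le> real n * d" using \<open>d > 0\<close> by (simp add: field_simps)
          then show ?thesis by (simp add: cut_def d_def)
        qed
        then show "\<forall>\<^sub>F n in sequentially. complex_of_real (cut n x) = 1"
          by (auto simp: eventually_sequentially intro!: exI[of _ n0])
      qed
      ultimately have "(\<lambda>n. of_real (cut n x) * K (g n x)) \<longlonglongrightarrow> 1 * K (f x)"
        by (rule tendsto_mult[rotated])
      then show "(\<lambda>n. \<psi> n x) \<longlonglongrightarrow> f x" by (simp add: \<psi>_def Kf)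
    qed
  qed
  have "(\<lambda>n. nsq (\<lambda>x. f x - \<psi> n x)) \<longlonglongrightarrow> (LINT x|torus. 0)"
    unfolding nsq_def
  proof (rule integral_dominated_convergence)
    show "integrable torus (\<lambda>x. (2 * B)\<^sup>2)" by simp
    show "AE x in torus. (\<lambda>n. (cmod (f x - \<psi> n x))\<^sup>2) \<longlonglongrightarrow> 0"
      using lim\<psi>
    proof eventually_elim
      fix x assume "(\<lambda>n. \<psi> n x) \<longlonglongrightarrow> f x"
      then have "(\<lambda>n. (cmod (f x - \<psi> n x))\<^sup>2) \<longlonglongrightarrow> (cmod (f x - f x))\<^sup>2"
        by (intro tendsto_intros)
      then show "(\<lambda>n. (cmod (f x - \<psi> n x))\<^sup>2) \<longlonglongrightarrow> 0" by simp
    qed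
    show "AE x in torus. norm ((cmod (f x - \<psi> n x))\<^sup>2) \<le> (2 * B)\<^sup>2" for n
    proof (rule AE_I2)
      fix x
      have "cmod (f x - \<psi> n x) \<le> 2 * B"
        using norm_triangle_ineq4[of "f x" "\<psi> n x"] B[of x] norm\<psi>[of n x] by linarith
      then show "norm ((cmod (f x - \<psi> n x))\<^sup>2) \<le> (2 * B)\<^sup>2"
        using power_mono[of "cmod (f x - \<psi> n x)" "2 * B" 2] by simp
    qed
  qed measurable
  then have "(\<lambda>n. nsq (\<lambda>x. f x - \<psi> n x)) \<longlonglongrightarrow> 0" by simp
  then have "\<forall>\<^sub>F n in sequentially. nsq (\<lambda>x. f x - \<psi> n x) < e / 4"
    using \<open>e > 0\<close> by (intro order_tendstoD) auto
  then obtain n where n: "nsq (\<lambda>x. f x - \<psi> n x) < e / 4"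
    by (auto simp: eventually_sequentially)
  have c: "continuous_on ?I (\<psi> n)" using cont\<psi> by (rule continuous_on_subset) simp
  have ends: "\<psi> n (-1/2) = \<psi> n (1/2)" by (simp add: \<psi>_def cut_def)
  \<comment> \<open>A uniform error below this root costs at most e/8 in \<open>nsq\<close>, as the
    total mass is 1. The budget is then 2 * (e/4) + 2 * (e/8) < e.\<close>
  have "sqrt (e / 8) > 0" using \<open>e > 0\<close> by simp
  then obtain p where p: "trig_poly p" "\<And>x. x \<in> ?I \<Longrightarrow> cmod (\<psi> n x - p x) < sqrt (e / 8)"
    by (rule trig_approx_continuous[OF c ends]) (rule that)
  have sp: "sq_int p" using p(1) by (rule sq_int_trig_poly)
  have "nsq (\<lambda>x. \<psi> n x - p x) \<le> (LINT x|torus. e / 8)"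
    unfolding nsq_def
  proof (rule integral_mono)
    show "integrable torus (\<lambda>x. (cmod (\<psi> n x - p x))\<^sup>2)"
      using sq_int_diff[OF s\<psi> sp] by (simp add: sq_int_def)
    fix x assume "x \<in> space torus"
    then have "cmod (\<psi> n x - p x) \<le> sqrt (e / 8)" using p(2)[of x] by simp
    then have "(cmod (\<psi> n x - p x))\<^sup>2 \<le> (sqrt (e / 8))\<^sup>2" by (rule power_mono) simp
    then show "(cmod (\<psi> n x - p x))\<^sup>2 \<le> e / 8" using \<open>e > 0\<close> by simp
  qed simp
  also have "\<dots> = e / 8" by (simp del: divide_minus_left)
  finally have "nsq (\<lambda>x. \<psi> n x - p x) \<le> e / 8" .
  moreover have "nsq (\<lambda>x. f x - p x) \<le> 2 * nsq (\<lambda>x. f x - \<psi> n x) + 2 * nsq (\<lambda>x. \<psi> n x - p x)"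
    using nsq_add_le[OF sq_int_diff[OF sf s\<psi>] sq_int_diff[OF s\<psi> sp], of n n] by simp
  ultimately have "nsq (\<lambda>x. f x - p x) < e" using n \<open>e > 0\<close> by linarith
  with p(1) show thesis by (rule that)
qed

lemma trig_poly_dense:
  assumes f: "sq_int f" and "e > 0"
  obtains p where "trig_poly p" "nsq (\<lambda>x. f x - p x) < e"
proof -
  note [measurable] = sq_int_measurable[OF f]
  \<comment> \<open>Truncation by height: each point is eventually unaffected, and the error is
    dominated by \<open>f\<close> itself.\<close>
  define h where "h n x = (if cmod (f x) \<le> real n then f x else 0)" for n x
  have [measurable]: "h n \<in> borel_measurable torus" for n unfolding h_def by measurable
  have "(\<lambda>n. nsq (\<lambda>x. f x - h n x)) \<longlonglongrightarrow> (LINT x|torus. 0)"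
    unfolding nsq_def
  proof (rule integral_dominated_convergence)
    show "integrable torus (\<lambda>x. (cmod (f x))\<^sup>2)" using f by (simp add: sq_int_def)
    show "AE x in torus. (\<lambda>n. (cmod (f x - h n x))\<^sup>2) \<longlonglongrightarrow> 0"
    proof (intro AE_I2 tendsto_eventually)
      fix x
      obtain n0 :: nat where "cmod (f x) < n0" using reals_Archimedean2 by blast
      then show "\<forall>\<^sub>F n in sequentially. (cmod (f x - h n x))\<^sup>2 = 0"
        by (auto simp: h_def eventually_sequentially intro!: exI[of _ n0])
    qed
    show "AE x in torus. norm ((cmod (f x - h n x))\<^sup>2) \<le> (cmod (f x))\<^sup>2" for n
      by (rule AE_I2) (simp add: h_def)
  qed measurable
  then have "(\<lambda>n. nsq (\<lambda>x. f x - h n x)) \<longlonglongrightarrow> 0" by simp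
  then have "\<forall>\<^sub>F n in sequentially. nsq (\<lambda>x. f x - h n x) < e / 4"
    using \<open>e > 0\<close> by (intro order_tendstoD) auto
  then obtain n where n: "nsq (\<lambda>x. f x - h n x) < e / 4"
    by (auto simp: eventually_sequentially)
  have bound: "cmod (h n x) \<le> real n + 1" for x by (auto simp: h_def)
  have sh: "sq_int (h n)" by (rule sq_int_bounded[OF _ bound]) measurable
  obtain p where p: "trig_poly p" "nsq (\<lambda>x. h n x - p x) < e / 4"
    by (rule trig_poly_dense_bounded[of "h n" "real n + 1" "e / 4"]) (use bound \<open>e > 0\<close> in auto)
  have sp: "sq_int p" using p(1) by (rule sq_int_trig_poly)
  have "nsq (\<lambda>x. f x - p x) \<le> 2 * nsq (\<lambda>x. f x - h n x) + 2 * nsq (\<lambda>x. h n x - p x)"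
    using nsq_add_le[OF sq_int_diff[OF f sh] sq_int_diff[OF sh sp]] by simp
  then have "nsq (\<lambda>x. f x - p x) < e" using n p(2) by linarith
  with p(1) show thesis by (rule that)
qed

text \<open>A Fourier sum of \<open>f\<close> is orthogonal to \<open>g\<close> term by term. By
  density and best approximation its remainder is arbitrarily small in mean square, so the inner
  product with \<open>g\<close> is arbitrarily small.\<close>

lemma orthogonal_if_disjoint_fourier_supports:
  assumes f: "sq_int f" and g: "sq_int g" and disj: "\<And>n. fcoeff f n = 0 \<or> fcoeff g n = 0"
  shows "(LINT x|torus. f x * cnj (g x)) = 0"
proof -
  have "cmod (LINT x|torus. f x * cnj (g x)) \<le> 0 + e" if "e > 0" for e
  proof -
    \<comment> \<open>Chosen so that \<open>nsq g / t\<close> is at most e/2; the added 1 keeps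
      \<open>t\<close> positive. An approximation error below e/(2t) then leaves
      \<open>t * nsq u\<close> below e/2.\<close>
    define t where "t = (nsq g + 1) / (e / 2)"
    have t: "t > 0" using \<open>e > 0\<close> nsq_nonneg[of g] by (simp add: t_def)
    have "e / (2 * t) > 0" using t \<open>e > 0\<close> by simp
    then obtain p where "trig_poly p" and p: "nsq (\<lambda>x. f x - p x) < e / (2 * t)"
      using trig_poly_dense[OF f] by blast
    then obtain S c where S: "finite S" and pS: "p = (\<lambda>x. \<Sum>n\<in>S. c n * chr n x)"
      using trig_poly_imp_sum by blast
    define s where "s x = (\<Sum>n\<in>S. fcoeff f n * chr n x)" for x
    define u where "u x = f x - s x" for x
    have ss: "sq_int s" unfolding s_def by (intro sq_int_sum sq_int_cmult sq_int_chr)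
    have su: "sq_int u" unfolding u_def by (intro sq_int_diff f ss)
    have cg: "sq_int (\<lambda>x. cnj (g x))" using g by (rule sq_int_cnj)
    have "nsq u < e / (2 * t)"
      using fourier_sum_best_approximation[OF f S, of c] p unfolding u_def s_def pS by linarith
    then have "t * nsq u < e / 2" using t by (simp add: field_simps)
    have "(LINT x|torus. s x * cnj (g x)) = (\<Sum>n\<in>S. fcoeff f n * (LINT x|torus. chr n x * cnj (g x)))"
      unfolding s_def sum_distrib_right mult.assoc
      using integrable_mult_sq_int[OF sq_int_chr cg] by (subst Bochner_Integration.integral_sum) auto
    also have "\<dots> = (\<Sum>n\<in>S. fcoeff f n * cnj (fcoeff g n))"
    proof -
      have "(LINT x|torus. chr n x * cnj (g x)) = cnj (fcoeff g n)" for n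
      proof -
        have "(LINT x|torus. chr n x * cnj (g x)) = (LINT x|torus. cnj (g x * cnj (chr n x)))"
          by (rule Bochner_Integration.integral_cong) auto
        then show ?thesis by (simp only: fcoeff_def Bochner_Integration.integral_cnj)
      qed
      then show ?thesis by simp
    qed
    also have "\<dots> = 0" using disj by (intro sum.neutral) auto
    finally have s0: "(LINT x|torus. s x * cnj (g x)) = 0" .
    have "(LINT x|torus. u x * cnj (g x)) = (LINT x|torus. f x * cnj (g x)) - (LINT x|torus. s x * cnj (g x))"
      unfolding u_def left_diff_distrib
      by (intro Bochner_Integration.integral_diff integrable_mult_sq_int f cg ss)
    then have "cmod (LINT x|torus. f x * cnj (g x)) = cmod (LINT x|torus. u x * cnj (g x))"
      using s0 by simp
    also have "\<dots> \<le> t * nsq u + nsq (\<lambda>x. cnj (g x)) / t"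
      by (rule norm_integral_mult_le[OF su cg t])
    also have "nsq (\<lambda>x. cnj (g x)) / t \<le> e / 2"
    proof -
      have "nsq g * e \<le> (nsq g + 1) * e" using \<open>e > 0\<close> by (intro mult_right_mono) auto
      then show ?thesis
        using nsq_nonneg[of g] \<open>e > 0\<close> by (simp add: nsq_def[of "\<lambda>x. cnj (g x)"] nsq_def[symmetric] t_def field_simps)
    qed
    finally show ?thesis using \<open>t * nsq u < e / 2\<close> by linarith
  qed
  then have "cmod (LINT x|torus. f x * cnj (g x)) \<le> 0" by (rule field_le_epsilon)
  then show ?thesis by simp
qed

section \<open>Injectivity\<close>

definition pw :: "(real \<Rightarrow> complex) \<Rightarrow> complex \<Rightarrow> complex" where
  "pw f z = (LINT x|torus. f x * exp (- 2 * complex_of_real pi * \<i> * z * complex_of_real x))"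

lemma set_lebesgue_integral_eq_torus:
  fixes f :: "real \<Rightarrow> 'a::{banach, second_countable_topology}"
  assumes [measurable]: "f \<in> borel_measurable borel"
  shows "(LINT x:{-1/2..1/2}|lborel. f x) = (LINT x|torus. f x)"
  unfolding torus_def set_lebesgue_integral_def
  by (subst integral_restrict_space, simp, subst integral_completion) simp_all

lemma set_integrable_iff_torus:
  fixes f :: "real \<Rightarrow> 'a::{banach, second_countable_topology}"
  assumes [measurable]: "f \<in> borel_measurable borel"
  shows "set_integrable lborel {-1/2..1/2} f \<longleftrightarrow> integrable torus f"
  unfolding torus_def set_integrable_def
  by (subst integrable_restrict_space, simp, subst integrable_completion) simp_all

lemma borel_measurable_torus: "f \<in> borel_measurable borel \<Longrightarrow> f \<in> borel_measurable torus"
  unfolding torus_def by (intro measurable_restrict_space1 measurable_completion) simp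

lemma L2_half_iff: "L2_half f \<longleftrightarrow> f \<in> borel_measurable borel \<and> sq_int f"
proof (cases "f \<in> borel_measurable borel")
  case True
  then have "(\<lambda>x. (cmod (f x))\<^sup>2) \<in> borel_measurable borel" by measurable
  from set_integrable_iff_torus[OF this] True borel_measurable_torus[OF True] show ?thesis
    by (simp add: L2_half_def sq_int_def)
qed (simp add: L2_half_def)

text \<open>For Borel functions, completing the measure changes neither integrability nor the
  integral, so \<open>torus\<close> may replace \<open>lborel\<close> on the interval.\<close>

lemma PW_eq: "PW = {pw f |f. f \<in> borel_measurable borel \<and> sq_int f}"
proof -
  have *: "(LINT x:{-1/2..1/2}|lborel. f x * exp (- 2 * complex_of_real pi * \<i> * z * complex_of_real x)) = pw f z"
    if [measurable]: "f \<in> borel_measurable borel" for f z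
    unfolding pw_def by (rule set_lebesgue_integral_eq_torus) measurable
  show ?thesis
    unfolding PW_def L2_half_iff using * by (auto simp: fun_eq_iff)
qed

lemma sq_int_id_mult: "sq_int f \<Longrightarrow> sq_int (\<lambda>x. of_real x * f x)"
  by (rule sq_int_mult_bounded[where B = "1/2"], assumption, rule borel_measurable_torus) auto

lemma norm_exp_torus_le:
  assumes "x \<in> {-1/2..1/2}"
  shows "cmod (exp (- 2 * complex_of_real pi * \<i> * z * complex_of_real x)) \<le> exp (pi * cmod z)"
proof -
  have "cmod (- 2 * complex_of_real pi * \<i> * z * complex_of_real x) = pi * cmod z * (2 * \<bar>x\<bar>)"
    by (simp add: norm_mult)
  also have "\<dots> \<le> pi * cmod z * 1"
    by (rule mult_left_mono) (use assms in auto)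
  finally have "exp (cmod (- 2 * complex_of_real pi * \<i> * z * complex_of_real x)) \<le> exp (pi * cmod z)"
    by simp
  with norm_exp show ?thesis by (rule order_trans)
qed

lemma sq_int_exp_mult:
  assumes "sq_int f"
  shows "sq_int (\<lambda>x. f x * exp (- 2 * complex_of_real pi * \<i> * z * complex_of_real x))"
proof -
  have "sq_int (\<lambda>x. exp (- 2 * complex_of_real pi * \<i> * z * complex_of_real x) * f x)"
    by (rule sq_int_mult_bounded[OF assms _ norm_exp_torus_le])
       (simp_all add: borel_measurable_torus)
  then show ?thesis by (simp only: mult.commute)
qed

lemma sq_int_imp_integrable:
  assumes "sq_int f"
  shows "integrable torus f"
  using integrable_mult_sq_int[OF assms sq_int_chr[of 0]] by simp

lemma pw_of_int: "pw f (of_int n) = fcoeff f n"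
proof -
  have "exp (- 2 * complex_of_real pi * \<i> * of_int n * complex_of_real x) = cnj (chr n x)" for x
    unfolding chr_def cis_cnj unfolding cis_conv_exp by (simp add: mult_ac)
  then show ?thesis by (simp add: pw_def fcoeff_def)
qed

lemma pw_diff:
  assumes "sq_int f" "sq_int g"
  shows "pw (\<lambda>x. f x - g x) z = pw f z - pw g z"
  unfolding pw_def left_diff_distrib
  by (rule Bochner_Integration.integral_diff) (rule sq_int_imp_integrable, rule sq_int_exp_mult, rule assms)+

text \<open>Differentiation under the integral: the second-order Taylor remainder of the exponential
  is bounded uniformly in x, so the error is quadratic in h.\<close>

lemma has_field_derivative_pw:
  assumes f: "sq_int f"
  shows "(pw f has_field_derivative - 2 * pi * \<i> * pw (\<lambda>x. of_real x * f x) z) (at z)"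
proof -
  define a where "a = - 2 * complex_of_real pi * \<i>"
  define D where "D = a * pw (\<lambda>x. of_real x * f x) z"
  \<comment> \<open>Product of the bounds for the Taylor remainder, for the kernel at
    \<open>z\<close>, and of the L1 norm of \<open>f\<close>. Restricting to |h| \<le> 1 keeps the
    exponent in the remainder below pi, so that \<open>C\<close> is independent of h.\<close>
  define C where "C = exp pi * pi\<^sup>2 * exp (pi * cmod z) * (LINT x|torus. cmod (f x))"
  have norm_a: "cmod a = 2 * pi" by (simp add: a_def norm_mult)
  have sx: "sq_int (\<lambda>x. of_real x * f x)" using f by (rule sq_int_id_mult)
  have rem: "cmod (pw f (z + h) - pw f z - h * D) \<le> C * (cmod h)\<^sup>2" if h: "cmod h \<le> 1" for h
  proof -
    define r where "r x = f x * exp (a * z * of_real x) * (exp (a * h * of_real x) - 1 - a * h * of_real x)" for x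
    have r_eq: "r = (\<lambda>x. f x * exp (a * (z + h) * of_real x) - f x * exp (a * z * of_real x)
        - h * a * (of_real x * f x * exp (a * z * of_real x)))"
      by (rule ext) (simp add: r_def algebra_simps exp_add)
    have i: "integrable torus (\<lambda>x. f x * exp (a * w * of_real x))"
        "integrable torus (\<lambda>x. of_real x * f x * exp (a * w * of_real x))" for w
      using sq_int_exp_mult[OF f, of w] sq_int_exp_mult[OF sx, of w]
      by (auto simp: a_def intro: sq_int_imp_integrable)
    have "(LINT x|torus. r x) = pw f (z + h) - pw f z - h * a * pw (\<lambda>x. of_real x * f x) z"
      unfolding r_eq pw_def a_def[symmetric] using i by simp
    then have "pw f (z + h) - pw f z - h * D = (LINT x|torus. r x)"
      by (simp add: D_def mult.assoc)
    also have "cmod \<dots> \<le> (LINT x|torus. cmod (r x))" by (rule integral_norm_bound)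
    also have "\<dots> \<le> (LINT x|torus. exp pi * pi\<^sup>2 * exp (pi * cmod z) * (cmod h)\<^sup>2 * cmod (f x))"
    proof (rule integral_mono)
      show "integrable torus (\<lambda>x. cmod (r x))"
        unfolding r_eq using i by simp
      show "integrable torus (\<lambda>x. exp pi * pi\<^sup>2 * exp (pi * cmod z) * (cmod h)\<^sup>2 * cmod (f x))"
        using sq_int_imp_integrable[OF f] by simp
      fix x assume "x \<in> space torus"
      then have x: "x \<in> {-1/2..1/2}" by simp
      define w where "w = a * h * of_real x"
      have "cmod w = pi * cmod h * (2 * \<bar>x\<bar>)" by (simp add: w_def norm_mult norm_a)
      also have "\<dots> \<le> pi * cmod h * 1" by (rule mult_left_mono) (use x in auto)
      finally have w: "cmod w \<le> pi * cmod h" by simp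
      also have "\<dots> \<le> pi * 1" using h by (intro mult_left_mono) auto
      finally have w': "cmod w \<le> pi" by simp
      have "cmod (exp w - 1 - w) \<le> exp (cmod w) * (cmod w)\<^sup>2"
        using Taylor_exp_field[of w 1] by (simp add: diff_diff_eq power2_eq_square)
      also have "\<dots> \<le> exp pi * (pi * cmod h)\<^sup>2"
        by (intro mult_mono power_mono w) (use w' in auto)
      finally have T: "cmod (exp w - 1 - w) \<le> exp pi * (pi * cmod h)\<^sup>2" .
      have "cmod (r x) = cmod (f x) * cmod (exp (a * z * of_real x)) * cmod (exp w - 1 - w)"
        by (simp add: r_def w_def norm_mult)
      also have "\<dots> \<le> cmod (f x) * exp (pi * cmod z) * (exp pi * (pi * cmod h)\<^sup>2)"
        using norm_exp_torus_le[OF x, of z] by (intro mult_mono T) (auto simp: a_def)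
      finally show "cmod (r x) \<le> exp pi * pi\<^sup>2 * exp (pi * cmod z) * (cmod h)\<^sup>2 * cmod (f x)"
        by (simp add: power_mult_distrib mult_ac)
    qed
    also have "\<dots> = C * (cmod h)\<^sup>2" by (simp add: C_def mult_ac)
    finally show ?thesis .
  qed
  have "((\<lambda>h. (pw f (z + h) - pw f z) / h - D) \<longlongrightarrow> 0) (at 0)"
  proof (rule Lim_null_comparison)
    show "\<forall>\<^sub>F h in at 0. cmod ((pw f (z + h) - pw f z) / h - D) \<le> C * cmod h"
      unfolding eventually_at
    proof (intro exI[of _ 1] conjI ballI impI)
      fix h :: complex assume h: "h \<noteq> 0 \<and> dist h 0 < 1"
      then have "(pw f (z + h) - pw f z) / h - D = (pw f (z + h) - pw f z - h * D) / h"
        by (simp add: field_simps)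
      then have "cmod ((pw f (z + h) - pw f z) / h - D) = cmod (pw f (z + h) - pw f z - h * D) / cmod h"
        by (simp add: norm_divide)
      also have "\<dots> \<le> C * (cmod h)\<^sup>2 / cmod h"
        using rem[of h] h by (intro divide_right_mono) auto
      also have "\<dots> = C * cmod h" by (simp add: power2_eq_square)
      finally show "cmod ((pw f (z + h) - pw f z) / h - D) \<le> C * cmod h" .
    qed simp
    show "((\<lambda>h. C * cmod h) \<longlongrightarrow> 0) (at 0)"
      by (intro tendsto_eq_intros) auto
  qed
  then have "(pw f has_field_derivative D) (at z)"
    unfolding DERIV_def by (rule Lim_null[THEN iffD2])
  then show ?thesis by (simp add: D_def a_def)
qed

text \<open>The normalisation of the derivative samples cancels the factor -2 pi i produced by
  differentiation.\<close>

lemma sample_map_pw: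
  assumes "sq_int f"
  shows "sample_map (pw f) n = (if n \<ge> 0 then fcoeff f n else fcoeff (\<lambda>x. of_real x * f x) n)"
proof -
  have "deriv (pw f) (of_int n) = - 2 * pi * \<i> * fcoeff (\<lambda>x. of_real x * f x) n"
    using DERIV_imp_deriv[OF has_field_derivative_pw[OF assms]] by (simp only: pw_of_int)
  then show ?thesis by (simp add: sample_map_def pw_of_int)
qed

text \<open>The two families of vanishing coefficients become an orthogonality relation between
  \<open>u\<close> and \<open>v\<close>, whose imaginary part is the integral of a nonnegative
  weight times |h|^2.\<close>

lemma AE_eq_0_if_samples_eq_0:
  assumes h: "sq_int h"
    and nonneg: "\<And>n. n \<ge> 0 \<Longrightarrow> fcoeff h n = 0"
    and neg: "\<And>n. n < 0 \<Longrightarrow> fcoeff (\<lambda>x. of_real x * h x) n = 0"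
  shows "AE x in torus. h x = 0"
proof -
  define u where "u x = of_real x * h x" for x
  define v where "v x = chr (-1) x * h x" for x
  define w where "w x = x * sin (2 * pi * x) * (cmod (h x))\<^sup>2" for x
  have su: "sq_int u" unfolding u_def using h by (rule sq_int_id_mult)
  have sv: "sq_int v" unfolding v_def by (rule sq_int_mult_bounded[OF h, of _ 1]) auto
  have uv_int: "integrable torus (\<lambda>x. u x * cnj (v x))"
    by (intro integrable_mult_sq_int sq_int_cnj su sv)
  \<comment> \<open>Multiplication by \<open>chr (-1)\<close> moves coefficient n + 1 to position n.
    Thus \<open>v\<close> has none for n \<ge> -1 and \<open>u\<close> none for n < 0, which
    together cover all integers.\<close>
  have "chr (-1) x * cnj (chr n x) = cnj (chr (n + 1) x)" for n x
    by (simp add: cnj_chr chr_mult algebra_simps)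
  then have "fcoeff v n = fcoeff h (n + 1)" for n
    by (simp add: fcoeff_def v_def mult_ac)
  then have "fcoeff u n = 0 \<or> fcoeff v n = 0" for n
    using nonneg[of "n + 1"] neg[of n] by (cases "n < 0") (auto simp: u_def[abs_def])
  then have 0: "(LINT x|torus. u x * cnj (v x)) = 0"
    by (rule orthogonal_if_disjoint_fourier_supports[OF su sv])
  have w: "w x = Im (u x * cnj (v x))" for x
  proof -
    have "u x * cnj (v x) = of_real x * chr 1 x * (h x * cnj (h x))"
      by (simp add: u_def v_def cnj_chr mult_ac)
    also have "\<dots> = of_real x * chr 1 x * of_real ((cmod (h x))\<^sup>2)"
      by (simp only: complex_norm_square)
    finally show ?thesis by (simp add: w_def chr_def)
  qed
  have "integrable torus w" unfolding w using uv_int by (rule integrable_Im)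
  moreover have "(LINT x|torus. w x) = 0" unfolding w using integral_Im[OF uv_int] 0 by simp
  \<comment> \<open>Inside the interval x and sin (2 pi x) have the same sign; the weight vanishes
    only at the three excluded points.\<close>
  moreover have pos: "x * sin (2 * pi * x) > 0" if "x \<in> {-1/2..1/2}" "x \<notin> {-1/2, 0, 1/2}" for x
  proof (cases "x > 0")
    case True
    then have "sin (2 * pi * x) > 0" by (intro sin_gt_zero) (use that in auto)
    then show ?thesis using True by simp
  next
    case False
    define y where "y = - x"
    have "0 < y" "y < 1/2" using False that by (auto simp: y_def)
    then have "sin (2 * pi * (- x)) > 0" unfolding y_def[symmetric] by (intro sin_gt_zero) auto
    then show ?thesis using False that by (simp add: mult_neg_neg)
  qed
  have "AE x in torus. 0 \<le> w x"
  proof (rule AE_I2)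
    fix x assume "x \<in> space torus"
    then have x: "x \<in> {-1/2..1/2}" by simp
    have "x * sin (2 * pi * x) \<ge> 0"
    proof (cases "x \<in> {-1/2, 0, 1/2}")
      case False
      then show ?thesis using pos[OF x] by simp
    next
      case True
      then consider "x = -1/2" | "x = 0" | "x = 1/2" by blast
      then have "sin (2 * pi * x) = 0" by cases (simp_all only: minus_divide_left[symmetric] mult_minus_right sin_minus, simp_all)
      then show ?thesis by auto
    qed
    then show "0 \<le> w x" by (simp add: w_def)
  qed
  ultimately have "AE x in torus. w x = 0"
    using integral_nonneg_eq_0_iff_AE by blast
  moreover have "AE x in torus. x \<notin> {-1/2, 0, 1/2}" by (rule AE_torus_not_in) simp
  moreover have "AE x in torus. x \<in> {-1/2..1/2}" by (rule AE_I2) simp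
  ultimately show ?thesis
  proof eventually_elim
    case (elim x)
    then show "h x = 0" using pos[of x] by (auto simp: w_def)
  qed
qed

lemma inj_on_sample_map: "inj_on sample_map PW"
proof (rule inj_onI)
  fix F G assume "F \<in> PW" "G \<in> PW" and eq: "sample_map F = sample_map G"
  then obtain f g where F: "F = pw f" and G: "G = pw g" and f: "sq_int f" and g: "sq_int g"
    unfolding PW_eq by blast
  define h where "h x = f x - g x" for x
  have h: "sq_int h" unfolding h_def using f g by (rule sq_int_diff)
  have "AE x in torus. h x = 0"
  proof (rule AE_eq_0_if_samples_eq_0[OF h])
    fix n :: int
    have s: "sample_map (pw f) n = sample_map (pw g) n" using eq F G by simp
    show "fcoeff h n = 0" if "n \<ge> 0"
      using s that by (simp add: sample_map_pw f g h_def[abs_def] fcoeff_diff)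
    show "fcoeff (\<lambda>x. of_real x * h x) n = 0" if "n < 0"
      using s that f g by (simp add: sample_map_pw h_def[abs_def] right_diff_distrib fcoeff_diff sq_int_id_mult)
  qed
  then have "pw h z = 0" for z
    unfolding pw_def by (intro integral_eq_zero_AE) auto
  then show "F = G"
    unfolding F G using pw_diff[OF f g] by (auto simp: h_def[abs_def])
qed

section \<open>Instability\<close>

lemma abs_sin_ge_half:
  fixes t :: real
  assumes "\<bar>t\<bar> \<le> pi / 2"
  shows "\<bar>t\<bar> / 2 \<le> \<bar>sin t\<bar>"
proof -
  \<comment> \<open>The value 1.6 exceeds pi/2 while its square 2.56 stays below 3, so the cubic
    error |t|^3/6 is at most |t|/2.\<close>
  have "\<bar>t\<bar> < 1.6" using assms pi_less_4 pi_approx by auto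
  then have t2: "t\<^sup>2 \<le> 1.6\<^sup>2" by (simp flip: abs_le_square_iff)
  have "\<bar>sin t - t\<bar> \<le> inverse (fact 3) * \<bar>t\<bar> ^ 3"
    using Maclaurin_sin_bound[of t 3] by (simp add: sin_coeff_def numeral_3_eq_3)
  also have "\<dots> = \<bar>t\<bar> * (t\<^sup>2 / 6)"
    by (simp add: fact_numeral power3_eq_cube power2_eq_square field_simps)
  also have "\<dots> \<le> \<bar>t\<bar> * (1 / 2)"
    using t2 by (intro mult_left_mono) (auto simp: power2_eq_square)
  finally show ?thesis by linarith
qed

lemma norm_cis_diff: "cmod (cis a - cis b) = 2 * \<bar>sin ((a - b) / 2)\<bar>"
proof -
  have "cis a - cis b = cis b * (exp (\<i> * of_real (a - b)) - 1)"
    unfolding cis_conv_exp[symmetric] by (simp add: right_diff_distrib cis_mult)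
  then show ?thesis by (simp only: norm_mult norm_cis dist_exp_i_1 mult_1_left)
qed

text \<open>Only negative frequencies occur, so all samples at n \<ge> 0 vanish. The sum peaks at x
  = 0, where multiplication by x tames it.\<close>

definition dirichlet :: "nat \<Rightarrow> real \<Rightarrow> complex" where
  "dirichlet N x = (\<Sum>n\<in>{- int N..-1}. chr n x)"

lemma dirichlet_Suc: "dirichlet (Suc N) x = chr (- int (Suc N)) x + dirichlet N x"
proof -
  have "{- int (Suc N)..-1} = insert (- int (Suc N)) {- int N..-1}" by auto
  then show ?thesis by (simp add: dirichlet_def)
qed

lemma dirichlet_telescope: "(chr 1 x - 1) * dirichlet N x = 1 - chr (- int N) x"
proof (induction N)
  case 0
  then show ?case by (simp add: dirichlet_def)
next
  case (Suc N)
  have "(chr 1 x - 1) * dirichlet (Suc N) x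
      = chr 1 x * chr (- int (Suc N)) x - chr (- int (Suc N)) x + (chr 1 x - 1) * dirichlet N x"
    by (simp only: dirichlet_Suc) (simp add: algebra_simps)
  also have "chr 1 x * chr (- int (Suc N)) x = chr (- int N) x"
    by (simp only: chr_mult) simp
  finally show ?case using Suc.IH by simp
qed

text \<open>The geometric sum has numerator at most 2, and its denominator
  \<open>chr 1 x - 1\<close> has modulus 2 |sin (pi x)|, at least pi |x|. The zero at the origin is
  cancelled by x, and N drops out.\<close>

lemma norm_id_mult_dirichlet_le:
  assumes "x \<in> {-1/2..1/2}"
  shows "cmod (of_real x * dirichlet N x) \<le> 2 / pi"
proof -
  have "\<bar>pi * x\<bar> = pi * \<bar>x\<bar>" by (simp add: abs_mult)
  also have "\<dots> \<le> pi * (1/2)" using assms by (intro mult_left_mono) auto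
  finally have "\<bar>pi * x\<bar> / 2 \<le> \<bar>sin (pi * x)\<bar>" by (intro abs_sin_ge_half) simp
  moreover have "cmod (chr 1 x - 1) = 2 * \<bar>sin (pi * x)\<bar>"
    using norm_cis_diff[of "2 * pi * x" 0] by (simp add: chr_def)
  ultimately have "pi * \<bar>x\<bar> \<le> cmod (chr 1 x - 1)" by (simp add: abs_mult)
  then have "pi * \<bar>x\<bar> * cmod (dirichlet N x) \<le> cmod (chr 1 x - 1) * cmod (dirichlet N x)"
    by (rule mult_right_mono) simp
  also have "\<dots> = cmod (1 - chr (- int N) x)"
    by (simp only: norm_mult[symmetric] dirichlet_telescope)
  also have "\<dots> \<le> 2" using norm_triangle_ineq4[of 1 "chr (- int N) x"] by simp
  finally show ?thesis by (simp add: norm_mult field_simps)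
qed

lemma sq_int_dirichlet: "sq_int (dirichlet N)"
  unfolding dirichlet_def by (intro sq_int_sum sq_int_chr)

lemma pw_dirichlet_in_PW: "pw (dirichlet N) \<in> PW"
proof -
  have "continuous_on UNIV (dirichlet N)"
    unfolding dirichlet_def by (intro continuous_intros)
  then show ?thesis
    unfolding PW_eq using sq_int_dirichlet borel_measurable_continuous_onI by blast
qed

lemma fcoeff_dirichlet: "fcoeff (dirichlet N) n = (if n \<in> {- int N..-1} then 1 else 0)"
  unfolding dirichlet_def by (simp add: fcoeff_sum fcoeff_chr)

lemma sample_norm_sq_dirichlet_le: "sample_norm_sq (pw (dirichlet N)) \<le> 1"
proof -
  define g where "g x = of_real x * dirichlet N x" for x
  have g: "sq_int g" unfolding g_def by (intro sq_int_id_mult sq_int_dirichlet)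
  have "nsq g \<le> (LINT x|torus. 1)"
    unfolding nsq_def
  proof (rule integral_mono)
    show "integrable torus (\<lambda>x. (cmod (g x))\<^sup>2)" using g by (simp add: sq_int_def)
    fix x assume "x \<in> space torus"
    then have "cmod (g x) \<le> 2 / pi" unfolding g_def by (intro norm_id_mult_dirichlet_le) simp
    also have "\<dots> \<le> 1" using pi_ge_two by simp
    finally show "(cmod (g x))\<^sup>2 \<le> 1" by (simp add: power_le_one)
  qed simp
  then have nsq_g: "nsq g \<le> 1" by (simp del: divide_minus_left)
  \<comment> \<open>At n \<ge> 0 the sample is 0; at n < 0 it is the coefficient of \<open>g\<close>
    itself.\<close>
  have "cmod (sample_map (pw (dirichlet N)) n) \<le> cmod (fcoeff g n)" for n
    by (simp add: sample_map_pw[OF sq_int_dirichlet] fcoeff_dirichlet g_def[abs_def])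
  then have *: "(cmod (sample_map (pw (dirichlet N)) n))\<^sup>2 \<le> (cmod (fcoeff g n))\<^sup>2" for n
    by (simp add: power_mono)
  show ?thesis
    unfolding sample_norm_sq_def
  proof (rule infsum_le_finite_sums)
    fix S :: "int set" assume S: "finite S"
    have "(\<Sum>n\<in>S. (cmod (sample_map (pw (dirichlet N)) n))\<^sup>2) \<le> (\<Sum>n\<in>S. (cmod (fcoeff g n))\<^sup>2)"
      by (rule sum_mono) (rule *)
    also have "\<dots> \<le> 1" using Bessel_inequality[OF g S] nsq_g by linarith
    finally show "(\<Sum>n\<in>S. ennreal ((cmod (sample_map (pw (dirichlet N)) n))\<^sup>2)) \<le> 1"
      by (simp add: sum_ennreal)
  qed (rule nonneg_summable_on_complete, simp)
qed

text \<open>The difference of the exponentials is at most 2 pi |s - t| |x|. Its factor |x| is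
  absorbed by the bound 2/pi on x times the Dirichlet sum, giving 4 for every N.\<close>

lemma pw_dirichlet_lipschitz:
  "cmod (pw (dirichlet N) (of_real s) - pw (dirichlet N) (of_real t)) \<le> 4 * \<bar>s - t\<bar>"
proof -
  let ?e = "\<lambda>r x. exp (- 2 * complex_of_real pi * \<i> * complex_of_real r * complex_of_real x)"
  have e: "?e r x = cis (- 2 * pi * r * x)" for r x
    by (simp add: cis_conv_exp mult_ac)
  have i: "integrable torus (\<lambda>x. dirichlet N x * ?e r x)" for r
    by (intro sq_int_imp_integrable sq_int_exp_mult sq_int_dirichlet)
  have "pw (dirichlet N) (of_real s) - pw (dirichlet N) (of_real t)
      = (LINT x|torus. dirichlet N x * ?e s x - dirichlet N x * ?e t x)"
    unfolding pw_def by (rule Bochner_Integration.integral_diff[symmetric]) (rule i)+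
  then have "cmod (pw (dirichlet N) (of_real s) - pw (dirichlet N) (of_real t))
      = cmod (LINT x|torus. dirichlet N x * ?e s x - dirichlet N x * ?e t x)" by (rule arg_cong)
  also have "\<dots> \<le> (LINT x|torus. cmod (dirichlet N x * ?e s x - dirichlet N x * ?e t x))"
    by (rule integral_norm_bound)
  also have "\<dots> \<le> (LINT x|torus. 4 * \<bar>s - t\<bar>)"
  proof (rule integral_mono)
    show "integrable torus (\<lambda>x. cmod (dirichlet N x * ?e s x - dirichlet N x * ?e t x))"
      by (rule integrable_norm, rule Bochner_Integration.integrable_diff) (rule i)+
    fix x assume "x \<in> space torus"
    then have x: "x \<in> {-1/2..1/2}" by simp
    have "cmod (?e s x - ?e t x) = 2 * \<bar>sin (pi * (t - s) * x)\<bar>"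
    proof -
      have "(- 2 * pi * s * x - - 2 * pi * t * x) / 2 = pi * (t - s) * x" by (simp add: field_simps)
      then show ?thesis unfolding e norm_cis_diff by (simp only:)
    qed
    also have "\<dots> \<le> 2 * \<bar>pi * (t - s) * x\<bar>"
      using abs_sin_x_le_abs_x by (intro mult_left_mono) auto
    finally have "cmod (?e s x - ?e t x) \<le> 2 * pi * \<bar>s - t\<bar> * \<bar>x\<bar>"
      by (simp add: abs_mult abs_minus_commute)
    then have "cmod (dirichlet N x) * cmod (?e s x - ?e t x)
        \<le> cmod (dirichlet N x) * (2 * pi * \<bar>s - t\<bar> * \<bar>x\<bar>)"
      by (rule mult_left_mono) simp
    also have "\<dots> = 2 * pi * \<bar>s - t\<bar> * cmod (of_real x * dirichlet N x)"
      by (simp add: norm_mult)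
    also have "\<dots> \<le> 2 * pi * \<bar>s - t\<bar> * (2 / pi)"
      by (rule mult_left_mono[OF norm_id_mult_dirichlet_le[OF x]]) simp
    also have "\<dots> = 4 * \<bar>s - t\<bar>" by simp
    finally show "cmod (dirichlet N x * ?e s x - dirichlet N x * ?e t x) \<le> 4 * \<bar>s - t\<bar>"
      by (simp only: norm_mult[symmetric] right_diff_distrib)
  qed simp
  also have "\<dots> = 4 * \<bar>s - t\<bar>" by (simp del: divide_minus_left)
  finally show ?thesis .
qed

text \<open>The function is 1 at each of N integers and stays at least 1/2 in modulus nearby, so
  every one of them contributes a fixed amount, (1/4) * (1/4), to the squared norm.\<close>

lemma L2_norm_sq_dirichlet_ge: "ennreal (real N / 16) \<le> L2_norm_sq (pw (dirichlet N))"
proof -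
  \<comment> \<open>Radius 1/8 against Lipschitz constant 4 allows a drop of at most 1/2, and
    intervals of length 1/4 around distinct integers are disjoint.\<close>
  define A where "A n = {real_of_int n - 1/8..real_of_int n + 1/8}" for n
  let ?S = "{- int N..-1}"
  have "disjoint_family_on A ?S"
  proof (unfold disjoint_family_on_def, intro ballI impI)
    fix m n :: int assume "m \<noteq> n"
    then have "1 \<le> \<bar>m - n\<bar>" by simp
    then have "\<bar>real_of_int m - real_of_int n\<bar> \<ge> 1"
      by (metis of_int_1_le_iff of_int_abs of_int_diff)
    then show "A m \<inter> A n = {}" unfolding A_def by auto
  qed
  then have "emeasure lborel (\<Union>n\<in>?S. A n) = (\<Sum>n\<in>?S. emeasure lborel (A n))"
    by (intro sum_emeasure[symmetric]) (auto simp: A_def[abs_def])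
  also have "\<dots> = (\<Sum>n\<in>?S. ennreal (1/4))" by (intro sum.cong) (auto simp: A_def)
  also have "\<dots> = ennreal (real N / 4)" by (subst sum_ennreal) simp_all
  finally have meas: "emeasure lborel (\<Union>n\<in>?S. A n) = ennreal (real N / 4)" .
  have "ennreal (1/4) * indicator (\<Union>n\<in>?S. A n) t \<le> ennreal ((cmod (pw (dirichlet N) (of_real t)))\<^sup>2)" for t
  proof (cases "t \<in> (\<Union>n\<in>?S. A n)")
    case True
    then obtain n where n: "n \<in> ?S" "t \<in> A n" by blast
    have "pw (dirichlet N) (of_real (of_int n)) = 1"
      using n(1) by (simp add: pw_of_int fcoeff_dirichlet)
    then have "cmod (1 - pw (dirichlet N) (of_real t)) \<le> 4 * \<bar>of_int n - t\<bar>"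
      using pw_dirichlet_lipschitz[of N "of_int n" t] by simp
    also have "\<dots> \<le> 1/2"
    proof -
      have "\<bar>of_int n - t\<bar> \<le> 1/8" by (rule abs_leI) (use n(2) in \<open>auto simp: A_def\<close>)
      then show ?thesis by simp
    qed
    finally have "cmod (pw (dirichlet N) (of_real t)) \<ge> 1/2"
      using norm_triangle_ineq2[of 1 "pw (dirichlet N) (of_real t)"] by simp
    then have "(1/2)\<^sup>2 \<le> (cmod (pw (dirichlet N) (of_real t)))\<^sup>2" by (rule power_mono) simp
    then show ?thesis using True by (simp add: power2_eq_square ennreal_leI)
  qed simp
  then have "(\<integral>\<^sup>+ t. ennreal (1/4) * indicator (\<Union>n\<in>?S. A n) t \<partial>lborel) \<le> L2_norm_sq (pw (dirichlet N))"
    unfolding L2_norm_sq_def by (intro nn_integral_mono)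
  moreover have "(\<integral>\<^sup>+ t. ennreal (1/4) * indicator (\<Union>n\<in>?S. A n) t \<partial>lborel) = ennreal (real N / 16)"
  proof -
    have "(\<Union>n\<in>?S. A n) \<in> sets lborel" by (auto simp: A_def)
    then have "(\<integral>\<^sup>+ t. ennreal (1/4) * indicator (\<Union>n\<in>?S. A n) t \<partial>lborel) = ennreal (1/4) * ennreal (real N / 4)"
      by (simp only: nn_integral_cmult_indicator meas)
    also have "\<dots> = ennreal (real N / 16)" by (subst ennreal_mult[symmetric]) simp_all
    finally show ?thesis .
  qed
  ultimately show ?thesis by simp
qed

lemma sample_map_unstable:
  "\<not> (\<exists>c::real. c > 0 \<and> (\<forall>F\<in>PW. ennreal c * L2_norm_sq F \<le> sample_norm_sq F))"
proof
  assume "\<exists>c::real. c > 0 \<and> (\<forall>F\<in>PW. ennreal c * L2_norm_sq F \<le> sample_norm_sq F)"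
  then obtain c :: real where c: "c > 0"
    and stable: "\<And>F. F \<in> PW \<Longrightarrow> ennreal c * L2_norm_sq F \<le> sample_norm_sq F" by blast
  \<comment> \<open>For this N the lower bound c * N/16 exceeds 1, the uniform upper bound on the
    samples.\<close>
  obtain N :: nat where N: "16 / c < real N" using reals_Archimedean2 by blast
  have "ennreal (c * (real N / 16)) = ennreal c * ennreal (real N / 16)"
    using c by (intro ennreal_mult) auto
  also have "\<dots> \<le> ennreal c * L2_norm_sq (pw (dirichlet N))"
    by (intro mult_left_mono L2_norm_sq_dirichlet_ge) simp
  also have "\<dots> \<le> sample_norm_sq (pw (dirichlet N))" by (rule stable[OF pw_dirichlet_in_PW])
  also have "\<dots> \<le> 1" by (rule sample_norm_sq_dirichlet_le)
  finally have "c * (real N / 16) \<le> 1" by simp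
  then show False using N c by (simp add: field_simps)
qed

theorem mainTheorem9:
  shows "inj_on sample_map PW \<and>
         \<not> (\<exists>c::real. c > 0 \<and> (\<forall>F\<in>PW. ennreal c * L2_norm_sq F \<le> sample_norm_sq F))"
  using inj_on_sample_map sample_map_unstable by blast

end
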